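(* Let $G$ be a nontrivial finite simple connected graph with maximum degree $\Delta$ and minimum degree $\delta$. Then $$\frac{1}{\sqrt{2}}\,GA(G) \le DSO(G) \le \frac{1}{2}\sqrt{\frac{\Delta}{\delta}+\frac{\delta}{\Delta}}\; GA(G).$$ Equality holds in the lower bound if and only if $G$ is a regular graph. Equality holds in the upper bound if and only if either $G$ is regular or $G$ is bipartite semiregular with part degrees $\Delta$ and $\delta$.
   Context: For a finite simple graph $G=(V(G),E(G))$, $d_u$ denotes the degree of the vertex $u$. A connected graph is nontrivial if it has at least two vertices (equivalently, at least one edge). The Diminished Sombor index is $DSO(G)=\sum_{uv\in E(G)}\frac{\sqrt{d_u^2+d_v^2}}{d_u+d_v}$. The geometric-arithmetic index is $GA(G)=\sum_{uv\in E(G)}\frac{2\sqrt{d_ud_v}}{d_u+d_v}$. A graph is bipartite semiregular with part degrees $r$ and $s$ if it is bipartite with a bipartition $(A,B)$ such that every vertex of $A$ has degree $r$ and every vertex of $B$ has degree $s$. *)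

theory Defs
  imports Complex_Main
begin

text \<open>A graph is given by its vertex set \<open>V\<close> and its set \<open>E\<close> of edges, an edge being the
  two-element set of its endpoints.\<close>

definition finite_simple_graph :: "'a set \<Rightarrow> 'a set set \<Rightarrow> bool" where
  "finite_simple_graph V E \<longleftrightarrow> finite V \<and> (\<forall>e\<in>E. e \<subseteq> V \<and> card e = 2)"

definition adj_rel :: "'a set set \<Rightarrow> 'a rel" where
  "adj_rel E = {(u, v). {u, v} \<in> E}"

definition connected_graph :: "'a set \<Rightarrow> 'a set set \<Rightarrow> bool" where
  "connected_graph V E \<longleftrightarrow> V \<noteq> {} \<and> (\<forall>u\<in>V. \<forall>v\<in>V. (u, v) \<in> (adj_rel E)\<^sup>*)"

definition degree :: "'a set set \<Rightarrow> 'a \<Rightarrow> nat" where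
  "degree E v = card {e \<in> E. v \<in> e}"

definition max_degree :: "'a set \<Rightarrow> 'a set set \<Rightarrow> nat" where
  "max_degree V E = Max (degree E ` V)"

definition min_degree :: "'a set \<Rightarrow> 'a set set \<Rightarrow> nat" where
  "min_degree V E = Min (degree E ` V)"

text \<open>In the two indices, the sums and the product over \<open>w \<in> e\<close> range over the two endpoints of the
  edge \<open>e\<close>: for \<open>e = {u, v}\<close> with \<open>u \<noteq> v\<close> the summands are
  \<open>sqrt (d\<^sub>u\<^sup>2 + d\<^sub>v\<^sup>2) / (d\<^sub>u + d\<^sub>v)\<close> and \<open>2 * sqrt (d\<^sub>u * d\<^sub>v) / (d\<^sub>u + d\<^sub>v)\<close>.\<close>

definition DSO :: "'a set set \<Rightarrow> real" where
  "DSO E = (\<Sum>e\<in>E. sqrt (\<Sum>w\<in>e. (real (degree E w))\<^sup>2) / (\<Sum>w\<in>e. real (degree E w)))"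

definition GA :: "'a set set \<Rightarrow> real" where
  "GA E = (\<Sum>e\<in>E. 2 * sqrt (\<Prod>w\<in>e. real (degree E w)) / (\<Sum>w\<in>e. real (degree E w)))"

definition regular_graph :: "'a set \<Rightarrow> 'a set set \<Rightarrow> bool" where
  "regular_graph V E \<longleftrightarrow> (\<exists>r. \<forall>v\<in>V. degree E v = r)"

definition bipartition :: "'a set \<Rightarrow> 'a set set \<Rightarrow> 'a set \<Rightarrow> 'a set \<Rightarrow> bool" where
  "bipartition V E A B \<longleftrightarrow>
     A \<union> B = V \<and> A \<inter> B = {} \<and> (\<forall>e\<in>E. \<exists>a\<in>A. \<exists>b\<in>B. e = {a, b})"

definition bipartite_semiregular :: "'a set \<Rightarrow> 'a set set \<Rightarrow> nat \<Rightarrow> nat \<Rightarrow> bool" where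
  "bipartite_semiregular V E r s \<longleftrightarrow>
     (\<exists>A B. bipartition V E A B \<and> (\<forall>a\<in>A. degree E a = r) \<and> (\<forall>b\<in>B. degree E b = s))"

end

theory Submission
  imports Defs
begin

text \<open>For positive \<open>x\<close> and \<open>y\<close>, factoring \<open>x\<^sup>2 + y\<^sup>2 = x y (x / y + y / x)\<close> under the square root gives
  \<open>sqrt (x\<^sup>2 + y\<^sup>2) / (x + y) = 1 / 2 * sqrt (x / y + y / x) * (2 * sqrt (x * y) / (x + y))\<close>.
  Hence the \<open>DSO\<close> term of an edge \<open>uv\<close> is its (positive) \<open>GA\<close> term times half the square root of
  the \<^emph>\<open>imbalance\<close> \<open>d\<^sub>u / d\<^sub>v + d\<^sub>v / d\<^sub>u\<close>, and any bound on the imbalance that is uniform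
  over the edges becomes a bound of \<open>DSO\<close> by a multiple of \<open>GA\<close>, with equality exactly when every
  single edge attains it (\<open>DSO_le_GA\<close>, \<open>DSO_ge_GA\<close>).

  The imbalance is at least \<open>2\<close>, attained only for equal degrees, and for degrees in
  \<open>[\<delta>, \<Delta>]\<close> it is at most \<open>\<Delta> / \<delta> + \<delta> / \<Delta>\<close>, attained only when the two degrees are the
  two ends of that interval (\<open>imbalance_ge_2\<close>, \<open>imbalance_le\<close>). Connectedness turns these
  conditions on edges into conditions on the graph: if degrees agree along every edge then they agree
  everywhere; and if every edge joins degree \<open>\<Delta>\<close> to degree \<open>\<delta>\<close>, then, every vertex lying on an edge,
  the degree classes form a bipartition (or coincide).\<close>

section \<open>The imbalance of a pair of positive reals\<close>

definition imbalance :: "real \<Rightarrow> real \<Rightarrow> real" where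
  "imbalance x y = x / y + y / x"

lemma imbalance_ge_2:
  assumes "x > 0" "y > 0"
  shows "2 \<le> imbalance x y" and "imbalance x y = 2 \<longleftrightarrow> x = y"
proof -
  have eq: "imbalance x y - 2 = (x - y)\<^sup>2 / (x * y)"
    using assms by (simp add: imbalance_def field_simps power2_eq_square)
  have "(x - y)\<^sup>2 / (x * y) \<ge> 0"
    using assms by simp
  with eq show "2 \<le> imbalance x y" by linarith
  have "imbalance x y = 2 \<longleftrightarrow> (x - y)\<^sup>2 / (x * y) = 0"
    using eq by linarith
  also have "\<dots> \<longleftrightarrow> x = y"
    using assms by simp
  finally show "imbalance x y = 2 \<longleftrightarrow> x = y" .
qed

text \<open>The gap to the bound factors as \<open>(x D - y d) (y D - x d) / (D d x y)\<close>. Both factors are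
  nonnegative because \<open>D d\<close> separates their two products, and a factor vanishes only if both of its
  products equal \<open>D d\<close>.\<close>

lemma imbalance_le:
  assumes "d > 0" "d \<le> x" "x \<le> D" "d \<le> y" "y \<le> D"
  shows "imbalance x y \<le> imbalance D d"
    and "imbalance x y = imbalance D d \<longleftrightarrow> x = D \<and> y = d \<or> x = d \<and> y = D"
proof -
  have pos: "x > 0" "y > 0" "D > 0" using assms by auto
  have eq: "imbalance D d - imbalance x y = (x * D - y * d) * (y * D - x * d) / (D * d * x * y)"
    using pos assms(1) by (simp add: imbalance_def field_simps)
  have sep: "d * D \<le> s * D" "s * d \<le> d * D" if "d \<le> s" "s \<le> D" for s
    using that pos assms(1) by (simp_all add: mult.commute)
  have "(x * D - y * d) * (y * D - x * d) \<ge> 0"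
    using sep[of x] sep[of y] assms by (intro mult_nonneg_nonneg) linarith+
  then have "(x * D - y * d) * (y * D - x * d) / (D * d * x * y) \<ge> 0"
    using pos assms(1) by simp
  with eq show "imbalance x y \<le> imbalance D d" by linarith
  have factor: "s * D - t * d = 0 \<longleftrightarrow> s = d \<and> t = D"
    if "d \<le> s" "s \<le> D" "d \<le> t" "t \<le> D" for s t
  proof
    assume "s * D - t * d = 0"
    then have "s * D = d * D" "t * d = D * d"
      using sep[of s] sep[of t] that by (simp_all add: mult.commute)
    then show "s = d \<and> t = D" using pos assms(1) by simp
  qed (simp add: mult.commute)
  have "imbalance x y = imbalance D d \<longleftrightarrow> (x * D - y * d) * (y * D - x * d) / (D * d * x * y) = 0"
    using eq by linarith
  also have "\<dots> \<longleftrightarrow> x * D - y * d = 0 \<or> y * D - x * d = 0"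
    using pos assms(1) by simp
  also have "\<dots> \<longleftrightarrow> x = D \<and> y = d \<or> x = d \<and> y = D"
    using factor assms by blast
  finally show "imbalance x y = imbalance D d \<longleftrightarrow> x = D \<and> y = d \<or> x = d \<and> y = D" .
qed

lemma sombor_term_eq:
  assumes "x > 0" "y > 0"
  shows "sqrt (x\<^sup>2 + y\<^sup>2) / (x + y) = 1 / 2 * sqrt (imbalance x y) * (2 * sqrt (x * y) / (x + y))"
proof -
  have "x\<^sup>2 + y\<^sup>2 = imbalance x y * (x * y)"
    using assms by (simp add: imbalance_def field_simps power2_eq_square)
  then show ?thesis by (simp add: real_sqrt_mult)
qed

section \<open>From the edges to the indices\<close>

lemma finite_edges:
  assumes "finite_simple_graph V E"
  shows "finite E"
proof -
  have "E \<subseteq> Pow V" "finite V"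
    using assms by (auto simp: finite_simple_graph_def)
  then show ?thesis by (meson finite_Pow_iff finite_subset)
qed

lemma edgeE:
  assumes "finite_simple_graph V E" "e \<in> E"
  obtains u v where "e = {u, v}" "u \<noteq> v" "u \<in> V" "v \<in> V"
proof -
  have "card e = 2" "e \<subseteq> V"
    using assms by (auto simp: finite_simple_graph_def)
  then obtain u v where "e = {u, v}" "u \<noteq> v"
    by (auto simp: card_2_iff)
  with \<open>e \<subseteq> V\<close> that show thesis by auto
qed

lemma degree_pos_of_edge:
  assumes "finite_simple_graph V E" "{u, v} \<in> E"
  shows "degree E u > 0" "degree E v > 0"
  using finite_edges[OF assms(1)] assms(2) by (auto simp: degree_def card_gt_0_iff)

abbreviation edge_imbalance :: "'a set set \<Rightarrow> 'a \<Rightarrow> 'a \<Rightarrow> real" where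
  "edge_imbalance E u v \<equiv> imbalance (real (degree E u)) (real (degree E v))"

definition DSO_term :: "'a set set \<Rightarrow> 'a set \<Rightarrow> real" where
  "DSO_term E e = sqrt (\<Sum>w\<in>e. (real (degree E w))\<^sup>2) / (\<Sum>w\<in>e. real (degree E w))"

definition GA_term :: "'a set set \<Rightarrow> 'a set \<Rightarrow> real" where
  "GA_term E e = 2 * sqrt (\<Prod>w\<in>e. real (degree E w)) / (\<Sum>w\<in>e. real (degree E w))"

lemma edge_terms:
  assumes "finite_simple_graph V E" "{u, v} \<in> E"
  shows "GA_term E {u, v} > 0"
    and "DSO_term E {u, v} = 1 / 2 * sqrt (edge_imbalance E u v) * GA_term E {u, v}"
proof -
  have "card {u, v} = 2"
    using assms by (auto simp: finite_simple_graph_def)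
  then have "u \<noteq> v" by auto
  moreover note pos = degree_pos_of_edge[OF assms]
  ultimately show "GA_term E {u, v} > 0"
    by (simp add: GA_term_def add_pos_pos)
  show "DSO_term E {u, v} = 1 / 2 * sqrt (edge_imbalance E u v) * GA_term E {u, v}"
    using sombor_term_eq[of "real (degree E u)" "real (degree E v)"] pos \<open>u \<noteq> v\<close>
    by (simp add: DSO_term_def GA_term_def)
qed

lemma edge_term_compare:
  assumes "finite_simple_graph V E" "{u, v} \<in> E"
  shows "DSO_term E {u, v} \<le> 1 / 2 * sqrt c * GA_term E {u, v} \<longleftrightarrow> edge_imbalance E u v \<le> c"
    and "1 / 2 * sqrt c * GA_term E {u, v} \<le> DSO_term E {u, v} \<longleftrightarrow> c \<le> edge_imbalance E u v"
  using edge_terms[OF assms] by simp_all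

lemma DSO_eq_sum: "DSO E = (\<Sum>e\<in>E. DSO_term E e)"
  by (simp add: DSO_def DSO_term_def)

lemma GA_scaled_eq_sum: "k * GA E = (\<Sum>e\<in>E. k * GA_term E e)"
  by (simp add: GA_def GA_term_def sum_distrib_left)

text \<open>On a single edge equality of the terms means that the imbalance is \<open>c\<close>, because the \<open>GA\<close> term
  cancels. The passage from equal sums to equal terms is a hypothesis because it holds for different
  reasons in the two bounds: there the terms are comparable in opposite directions.\<close>

lemma sums_eq_iff_imbalance_const:
  assumes G: "finite_simple_graph V E"
    and eq_iff: "DSO E = 1 / 2 * sqrt c * GA E \<longleftrightarrow>
      (\<forall>e\<in>E. DSO_term E e = 1 / 2 * sqrt c * GA_term E e)"
  shows "DSO E = 1 / 2 * sqrt c * GA E \<longleftrightarrow> (\<forall>u v. {u, v} \<in> E \<longrightarrow> edge_imbalance E u v = c)"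
proof -
  have edge: "DSO_term E {u, v} = 1 / 2 * sqrt c * GA_term E {u, v} \<longleftrightarrow> edge_imbalance E u v = c"
    if "{u, v} \<in> E" for u v
    using edge_term_compare[OF G that, of c] by (simp add: order_eq_iff)
  show ?thesis
    unfolding eq_iff
  proof (intro iffI allI impI ballI)
    fix u v assume "\<forall>e\<in>E. DSO_term E e = 1 / 2 * sqrt c * GA_term E e" "{u, v} \<in> E"
    then show "edge_imbalance E u v = c" using edge by blast
  next
    fix e assume *: "\<forall>u v. {u, v} \<in> E \<longrightarrow> edge_imbalance E u v = c" "e \<in> E"
    then obtain u v where "e = {u, v}" using edgeE[OF G] by metis
    then show "DSO_term E e = 1 / 2 * sqrt c * GA_term E e" using * edge by blast
  qed
qed

text \<open>For termwise comparable sums over the finite edge set, equality of the sums forces equality of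
  every term; this is what makes the equality case local.\<close>

lemma DSO_le_GA:
  assumes G: "finite_simple_graph V E"
    and le: "\<And>u v. {u, v} \<in> E \<Longrightarrow> edge_imbalance E u v \<le> c"
  shows "DSO E \<le> 1 / 2 * sqrt c * GA E"
    and "DSO E = 1 / 2 * sqrt c * GA E \<longleftrightarrow> (\<forall>u v. {u, v} \<in> E \<longrightarrow> edge_imbalance E u v = c)"
proof -
  have termwise: "DSO_term E e \<le> 1 / 2 * sqrt c * GA_term E e" if e: "e \<in> E" for e
  proof -
    obtain u v where "e = {u, v}" using edgeE[OF G e] by metis
    then show ?thesis using edge_term_compare(1)[OF G] le e by blast
  qed
  then show "DSO E \<le> 1 / 2 * sqrt c * GA E"
    unfolding DSO_eq_sum GA_scaled_eq_sum by (rule sum_mono)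
  show "DSO E = 1 / 2 * sqrt c * GA E \<longleftrightarrow> (\<forall>u v. {u, v} \<in> E \<longrightarrow> edge_imbalance E u v = c)"
  proof (rule sums_eq_iff_imbalance_const[OF G], unfold DSO_eq_sum GA_scaled_eq_sum, rule iffI)
    assume "(\<Sum>e\<in>E. DSO_term E e) = (\<Sum>e\<in>E. 1 / 2 * sqrt c * GA_term E e)"
    note pointwise = sum_mono_inv[OF this termwise _ finite_edges[OF G]]
    show "\<forall>e\<in>E. DSO_term E e = 1 / 2 * sqrt c * GA_term E e"
      by (rule ballI, rule pointwise)
  qed (rule sum.cong[OF refl], erule bspec)
qed

lemma DSO_ge_GA:
  assumes G: "finite_simple_graph V E"
    and ge: "\<And>u v. {u, v} \<in> E \<Longrightarrow> c \<le> edge_imbalance E u v"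
  shows "1 / 2 * sqrt c * GA E \<le> DSO E"
    and "DSO E = 1 / 2 * sqrt c * GA E \<longleftrightarrow> (\<forall>u v. {u, v} \<in> E \<longrightarrow> edge_imbalance E u v = c)"
proof -
  have termwise: "1 / 2 * sqrt c * GA_term E e \<le> DSO_term E e" if e: "e \<in> E" for e
  proof -
    obtain u v where "e = {u, v}" using edgeE[OF G e] by metis
    then show ?thesis using edge_term_compare(2)[OF G] ge e by blast
  qed
  then show "1 / 2 * sqrt c * GA E \<le> DSO E"
    unfolding DSO_eq_sum GA_scaled_eq_sum by (rule sum_mono)
  show "DSO E = 1 / 2 * sqrt c * GA E \<longleftrightarrow> (\<forall>u v. {u, v} \<in> E \<longrightarrow> edge_imbalance E u v = c)"
  proof (rule sums_eq_iff_imbalance_const[OF G], unfold DSO_eq_sum GA_scaled_eq_sum, rule iffI)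
    assume "(\<Sum>e\<in>E. DSO_term E e) = (\<Sum>e\<in>E. 1 / 2 * sqrt c * GA_term E e)"
    note pointwise = sum_mono_inv[OF this[symmetric] termwise _ finite_edges[OF G]]
    show "\<forall>e\<in>E. DSO_term E e = 1 / 2 * sqrt c * GA_term E e"
      by (rule ballI, rule pointwise[symmetric])
  qed (rule sum.cong[OF refl], erule bspec)
qed

section \<open>Degrees in connected graphs\<close>

lemma connected_vertex_on_edge:
  assumes "connected_graph V E" "card V \<ge> 2" "v \<in> V"
  obtains w where "{v, w} \<in> E"
proof -
  have "\<not> V \<subseteq> {v}"
    using assms(2) card_mono[of "{v}" V] by auto
  then obtain x where "x \<in> V" "x \<noteq> v" by blast
  then have "(v, x) \<in> (adj_rel E)\<^sup>*"
    using assms by (auto simp: connected_graph_def)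
  then show thesis
    using \<open>x \<noteq> v\<close> that by (cases rule: converse_rtranclE) (auto simp: adj_rel_def)
qed

lemma regular_iff_edges_balanced:
  assumes "finite_simple_graph V E" "connected_graph V E"
  shows "regular_graph V E \<longleftrightarrow> (\<forall>u v. {u, v} \<in> E \<longrightarrow> degree E u = degree E v)"
proof
  assume "regular_graph V E"
  moreover have "u \<in> V \<and> v \<in> V" if "{u, v} \<in> E" for u v
    using assms(1) that by (auto simp: finite_simple_graph_def)
  ultimately show "\<forall>u v. {u, v} \<in> E \<longrightarrow> degree E u = degree E v"
    by (metis regular_graph_def)
next
  assume bal: "\<forall>u v. {u, v} \<in> E \<longrightarrow> degree E u = degree E v"
  have path: "degree E u = degree E v" if "(u, v) \<in> (adj_rel E)\<^sup>*" for u v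
    using that by (induction rule: rtrancl_induct) (auto simp: adj_rel_def bal)
  obtain u where "u \<in> V" using assms(2) by (auto simp: connected_graph_def)
  then have "\<forall>v\<in>V. degree E v = degree E u"
    using assms(2) path by (metis connected_graph_def)
  then show "regular_graph V E" by (auto simp: regular_graph_def)
qed

lemma degree_between:
  assumes "finite V" "v \<in> V"
  shows "min_degree V E \<le> degree E v" "degree E v \<le> max_degree V E"
  using assms by (simp_all add: min_degree_def max_degree_def)

lemma min_degree_attained:
  assumes "finite V" "V \<noteq> {}"
  obtains v where "v \<in> V" "degree E v = min_degree V E"
proof -
  have "Min (degree E ` V) \<in> degree E ` V"
    using assms by (intro Min_in) auto
  then show thesis
    using that by (auto simp: min_degree_def)
qed

lemma regular_degree_extreme:
  assumes "finite V" "regular_graph V E" "v \<in> V"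
  shows "degree E v = max_degree V E" "degree E v = min_degree V E"
proof -
  obtain r where "\<forall>v\<in>V. degree E v = r"
    using assms(2) by (auto simp: regular_graph_def)
  moreover from this have "degree E ` V = {r}" using assms(3) by auto
  ultimately show "degree E v = max_degree V E" "degree E v = min_degree V E"
    using assms(3) by (simp_all add: max_degree_def min_degree_def)
qed

text \<open>If \<open>D = d\<close>, the edge condition says that the graph is regular. Otherwise the sets of vertices of
  degree \<open>D\<close> and of degree \<open>d\<close> are disjoint, and they cover \<open>V\<close> because no vertex is isolated.\<close>

lemma regular_or_semiregular_iff_edges_extreme:
  assumes G: "finite_simple_graph V E" and con: "connected_graph V E" and two: "card V \<ge> 2"
    and D: "D = max_degree V E" and d: "d = min_degree V E"
  shows "regular_graph V E \<or> bipartite_semiregular V E D d \<longleftrightarrow>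
    (\<forall>u v. {u, v} \<in> E \<longrightarrow> degree E u = D \<and> degree E v = d \<or> degree E u = d \<and> degree E v = D)"
    (is "_ \<longleftrightarrow> ?extreme")
proof
  assume "regular_graph V E \<or> bipartite_semiregular V E D d"
  then show ?extreme
  proof
    assume reg: "regular_graph V E"
    have "finite V" "u \<in> V" "v \<in> V" if "{u, v} \<in> E" for u v
      using G that by (auto simp: finite_simple_graph_def)
    then show ?extreme
      using regular_degree_extreme[OF _ reg] D d by metis
  next
    assume "bipartite_semiregular V E D d"
    then obtain A B where AB: "bipartition V E A B"
      and "\<forall>a\<in>A. degree E a = D" "\<forall>b\<in>B. degree E b = d"
      by (auto simp: bipartite_semiregular_def)
    moreover have "u \<in> A \<and> v \<in> B \<or> u \<in> B \<and> v \<in> A" if uv: "{u, v} \<in> E" for u v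
    proof -
      obtain a b where "a \<in> A" "b \<in> B" "{u, v} = {a, b}"
        using AB uv unfolding bipartition_def by metis
      then show ?thesis by (auto simp: doubleton_eq_iff)
    qed
    ultimately show ?extreme by blast
  qed
next
  assume ext: ?extreme
  show "regular_graph V E \<or> bipartite_semiregular V E D d"
  proof (cases "D = d")
    case True
    then show ?thesis
      using ext regular_iff_edges_balanced[OF G con] by metis
  next
    case False
    let ?A = "{v \<in> V. degree E v = D}" and ?B = "{v \<in> V. degree E v = d}"
    have "degree E v = D \<or> degree E v = d" if "v \<in> V" for v
      using connected_vertex_on_edge[OF con two that] ext by metis
    then have "?A \<union> ?B = V" by blast
    moreover have "?A \<inter> ?B = {}" using False by auto
    moreover have "\<exists>a\<in>?A. \<exists>b\<in>?B. e = {a, b}" if e: "e \<in> E" for e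
    proof -
      obtain u v where uv: "e = {u, v}" "u \<in> V" "v \<in> V" using edgeE[OF G e] by metis
      with ext e have "u \<in> ?A \<and> v \<in> ?B \<or> u \<in> ?B \<and> v \<in> ?A" by blast
      then show ?thesis
      proof
        assume "u \<in> ?A \<and> v \<in> ?B"
        with uv(1) show ?thesis by blast
      next
        assume "u \<in> ?B \<and> v \<in> ?A"
        moreover have "e = {v, u}" using uv(1) by (simp add: insert_commute)
        ultimately show ?thesis by blast
      qed
    qed
    ultimately have "bipartition V E ?A ?B" by (simp add: bipartition_def)
    then have "bipartite_semiregular V E D d"
      unfolding bipartite_semiregular_def by blast
    then show ?thesis ..
  qed
qed

section \<open>The two bounds\<close>

theorem theorem7:
  fixes V :: "'a set" and E :: "'a set set" and \<Delta> \<delta> :: nat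
  assumes "finite_simple_graph V E"
    and "connected_graph V E"
    and "card V \<ge> 2"
    and "\<Delta> = max_degree V E"
    and "\<delta> = min_degree V E"
  shows "1 / sqrt 2 * GA E \<le> DSO E
    \<and> DSO E \<le> 1 / 2 * sqrt (real \<Delta> / real \<delta> + real \<delta> / real \<Delta>) * GA E
    \<and> (DSO E = 1 / sqrt 2 * GA E \<longleftrightarrow> regular_graph V E)
    \<and> (DSO E = 1 / 2 * sqrt (real \<Delta> / real \<delta> + real \<delta> / real \<Delta>) * GA E
         \<longleftrightarrow> regular_graph V E \<or> bipartite_semiregular V E \<Delta> \<delta>)"
proof -
  note G = assms(1) and con = assms(2) and two = assms(3)
  have fin: "finite V" using G by (simp add: finite_simple_graph_def)
  have "V \<noteq> {}" using con by (simp add: connected_graph_def)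
  then obtain v\<^sub>0 where "v\<^sub>0 \<in> V" "degree E v\<^sub>0 = \<delta>"
    using min_degree_attained[OF fin] assms(5) by metis
  then have "\<delta> > 0"
    using connected_vertex_on_edge[OF con two] degree_pos_of_edge(1)[OF G] by metis
  have inV: "u \<in> V" "v \<in> V" if "{u, v} \<in> E" for u v
    using G that by (auto simp: finite_simple_graph_def)
  have range: "\<delta> \<le> degree E v" "degree E v \<le> \<Delta>" if "v \<in> V" for v
    using degree_between[OF fin that] assms(4,5) by simp_all
  note pos = degree_pos_of_edge[OF G]

  have low: "2 \<le> edge_imbalance E u v" "edge_imbalance E u v = 2 \<longleftrightarrow> degree E u = degree E v"
    if "{u, v} \<in> E" for u v
    using imbalance_ge_2[of "real (degree E u)" "real (degree E v)"] pos[OF that] by simp_all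
  have up: "edge_imbalance E u v \<le> imbalance \<Delta> \<delta>"
    "edge_imbalance E u v = imbalance \<Delta> \<delta> \<longleftrightarrow>
      degree E u = \<Delta> \<and> degree E v = \<delta> \<or> degree E u = \<delta> \<and> degree E v = \<Delta>"
    if "{u, v} \<in> E" for u v
    using imbalance_le[of "real \<delta>" "real (degree E u)" "real \<Delta>" "real (degree E v)"]
      \<open>\<delta> > 0\<close> range[OF inV(1)[OF that]] range[OF inV(2)[OF that]] by simp_all

  have half_sqrt_2: "1 / sqrt 2 = 1 / 2 * sqrt 2"
    by (simp add: real_div_sqrt field_simps)
  have "1 / sqrt 2 * GA E \<le> DSO E"
    unfolding half_sqrt_2 using low(1) by (rule DSO_ge_GA(1)[OF G])
  moreover have "DSO E \<le> 1 / 2 * sqrt (imbalance \<Delta> \<delta>) * GA E"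
    using up(1) by (rule DSO_le_GA(1)[OF G])
  moreover have "DSO E = 1 / sqrt 2 * GA E \<longleftrightarrow> regular_graph V E"
    unfolding half_sqrt_2 regular_iff_edges_balanced[OF G con]
    using DSO_ge_GA(2)[OF G low(1)] low(2) by simp
  moreover have "DSO E = 1 / 2 * sqrt (imbalance \<Delta> \<delta>) * GA E
      \<longleftrightarrow> regular_graph V E \<or> bipartite_semiregular V E \<Delta> \<delta>"
    unfolding regular_or_semiregular_iff_edges_extreme[OF G con two assms(4,5)]
    using DSO_le_GA(2)[OF G up(1)] up(2) by simp
  ultimately show ?thesis
    unfolding imbalance_def by blast
qed

end
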